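(* Let $f:\mathbb{R}^k\to\mathbb{R}$ be twice differentiable, $L$-smooth and $\mu$-strongly convex with $L,\mu>0$, and suppose $f(x)=\sum_{i=1}^kf_i(x^{(i)})$ for functions $f_i:\mathbb{R}\to\mathbb{R}$. Let $x^*$ be the minimizer of $f$. Let $0<\alpha<1$, $\beta\in\mathbb{R}$, $\gamma=\frac{1-\alpha}{2-\alpha}$, and set $$K_1=\tfrac{L+\mu}{2}(\beta-\gamma),\qquad K_2=\begin{cases}\tfrac{L-\mu}{2}(\beta+\gamma)&\text{if }\beta\ge0,\\ \tfrac{\mu-L}{2}(\beta-\gamma)&\text{if }\beta\le0.\end{cases}$$ Let $0<\phi<2$, $\epsilon>0$, and let $(\lambda_t)_{t\ge0}$ be real numbers with $1-K_1\lambda_t-K_2|\lambda_t|>\epsilon$ for all $t$. Let $x_0\in\mathbb{R}^k$ and define, for $t\ge0$, $$x_{t+1}=x_t-\eta_t\,{}^{C}\delta^{\alpha,\beta}_{c_t}f(x_t),\qquad \eta_t=\frac{(1-K_1\lambda_t-K_2|\lambda_t|)\phi}{(1-K_1\lambda_t+K_2|\lambda_t|)^2L},\qquad x_t-c_t=-\lambda_t\nabla f(x_t).$$ Then for all $t\ge0$, $$\|x_{t+1}-x^*\|_2^2\le\left[1-(2-\phi)\phi\frac{\mu}{L}\left(\frac{1-K_1\lambda_t-K_2|\lambda_t|}{1-K_1\lambda_t+K_2|\lambda_t|}\right)^2\right]\|x_t-x^*\|_2^2 .$$ In particular, this rate is at best the same as that of gradient descent: the bracketed factor is at least $1-\fr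ac{\mu}{L}$.
   Context: $x^{(i)}$ denotes the $i$th coordinate of $x\in\mathbb{R}^k$. $f:\mathbb{R}^k\to\mathbb{R}$ is $L$-smooth if $|f(y)-f(x)-\langle\nabla f(x),y-x\rangle|\le\frac L2\|y-x\|_2^2$ for all $x,y$, and $\mu$-strongly convex if $f(y)-f(x)-\langle\nabla f(x),y-x\rangle\ge\frac\mu2\|y-x\|_2^2$ for all $x,y$. For $g:\mathbb{R}\to\mathbb{R}$, non-integer $\nu>0$, $n=\lceil\nu\rceil$ and real $x\ne c$, the Caputo derivative is $${}^{C}D^{\nu}_{c}g(x)=\frac{(\operatorname{sgn}(x-c))^{n-1}}{\Gamma(n-\nu)}\int_c^x\frac{g^{(n)}(t)}{|x-t|^{\nu-n+1}}\,dt ,$$ with $\operatorname{sgn}$ the sign function, $\Gamma$ the gamma function, and $\int_c^x$ the oriented integral. For $\alpha\in(0,1)$, $\beta\in\mathbb{R}$, real $x\neq c$, $${}^{C}\delta^{\alpha,\beta}_{c}g(x)=\frac{\Gamma(2-\alpha)|x-c|^{\alpha}}{x-c}\Big({}^{C}D^{\alpha}_{c}g(x)+\beta|x-c|\,{}^{C}D^{1+\alpha}_{c}g(x)\Big),$$ and for $c=x$ it is read as its limiting value $g'(x)$. For $f:\mathbb{R}^k\to\mathbb{R}$ and $x,c\in\mathbb{R}^k$, $${}^{C}\delta^{\alpha,\beta}_{c}f(x)=\big[{}^{C}\delta^{\alpha,\beta}_{c^{(1)}}f_{1,x}(x^{(1)}),\dots,{}^{C}\delta^{\alpha,\beta}_{c^{(k)}}f_{k,x}(x^{(k)})\big],\qquad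 f_{j,x}(y)=f\big(x+(y-x^{(j)})e^{(j)}\big),$$ where $e^{(j)}$ is the $j$th standard unit vector. *)

theory Defs
  imports "HOL-Analysis.Analysis"
begin

definition grad :: "('a::euclidean_space \<Rightarrow> real) \<Rightarrow> 'a \<Rightarrow> 'a" where
  "grad f x = (THE D. GDERIV f x :> D)"

definition twice_differentiable :: "('a::euclidean_space \<Rightarrow> real) \<Rightarrow> bool" where
  "twice_differentiable f \<longleftrightarrow>
     (\<forall>x. f differentiable (at x)) \<and> (\<forall>x. grad f differentiable (at x))"

(* As usual for these two notions, f is understood to be differentiable. *)
definition L_smooth :: "real \<Rightarrow> ('a::euclidean_space \<Rightarrow> real) \<Rightarrow> bool" where
  "L_smooth L f \<longleftrightarrow>
     (\<forall>x y. \<bar>f y - f x - grad f x \<bullet> (y - x)\<bar> \<le> L / 2 * (norm (y - x))\<^sup>2)"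

definition strongly_convex :: "real \<Rightarrow> ('a::euclidean_space \<Rightarrow> real) \<Rightarrow> bool" where
  "strongly_convex \<mu> f \<longleftrightarrow>
     (\<forall>x y. f y - f x - grad f x \<bullet> (y - x) \<ge> \<mu> / 2 * (norm (y - x))\<^sup>2)"

(* Meaningful for non-integer \<nu> > 0 and x \<noteq> c.  The interval Lebesgue integral is oriented:
   it changes sign when c > x.  The value of the integrand at the endpoint t = x is irrelevant. *)
definition caputo_deriv :: "real \<Rightarrow> real \<Rightarrow> (real \<Rightarrow> real) \<Rightarrow> real \<Rightarrow> real" where
  "caputo_deriv \<nu> c g x =
     (let n = nat \<lceil>\<nu>\<rceil> in
       (sgn (x - c)) ^ (n - 1) / Gamma (real n - \<nu>) *
       (LBINT t=ereal c..ereal x. (deriv ^^ n) g t / \<bar>x - t\<bar> powr (\<nu> - real n + 1)))"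

(* At c = x the operator is given its limiting value, the ordinary derivative. *)
definition caputo_delta :: "real \<Rightarrow> real \<Rightarrow> real \<Rightarrow> (real \<Rightarrow> real) \<Rightarrow> real \<Rightarrow> real" where
  "caputo_delta \<alpha> \<beta> c g x =
     (if c = x then deriv g x
      else Gamma (2 - \<alpha>) * \<bar>x - c\<bar> powr \<alpha> / (x - c) *
           (caputo_deriv \<alpha> c g x + \<beta> * \<bar>x - c\<bar> * caputo_deriv (1 + \<alpha>) c g x))"

definition caputo_grad ::
  "real \<Rightarrow> real \<Rightarrow> real ^ 'n \<Rightarrow> (real ^ 'n \<Rightarrow> real) \<Rightarrow> real ^ 'n \<Rightarrow> real ^ 'n" where
  "caputo_grad \<alpha> \<beta> c f x =
     (\<chi> j. caputo_delta \<alpha> \<beta> (c $ j) (\<lambda>y. f (x + (y - x $ j) *\<^sub>R axis j 1)) (x $ j))"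

end

theory Submission
  imports Defs
begin

text \<open>
  The separability of the objective reduces everything to one real variable.  Fix a coordinate,
  let \<open>g\<close> be the restriction of the objective to the corresponding line, \<open>G = g'\<close>, \<open>G' = g''\<close>,
  and put \<open>h = x - c\<close>.  The substitution \<open>t = x - h u\<close> turns both Caputo integrals into
  integrals over the unit interval, whatever the sign of \<open>h\<close>, and gives
  \[
    \delta g (x) = (1 - \alpha) \left(\int_0^1 G (x - h u) u^{-\alpha} du
      + \beta h \int_0^1 G' (x - h u) u^{-\alpha} du\right) .
  \]
  Smoothness and strong convexity say that \<open>\<mu> \<le> G' \<le> L\<close>, that is, \<open>\<bar>G' - m\<bar> \<le> d\<close> for
  \<open>m = (L + \<mu>) / 2\<close> and \<open>d = (L - \<mu>) / 2\<close>; hence \<open>G (x - h u)\<close> differs from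
  \<open>G x - m h u\<close> by at most \<open>d \<bar>h\<bar> u\<close>.  Replacing \<open>G (x - h u)\<close> by \<open>G x - m h u\<close> and
  \<open>G' (x - h u)\<close> by \<open>m\<close> gives exactly \<open>G x + h m (\<beta> - \<gamma>)\<close>, and the error is at most
  \<open>\<bar>h\<bar> d (\<bar>\<beta>\<bar> + \<gamma>)\<close> (lemma \<open>caputo_delta_approx\<close>).  These two coefficients are
  \<open>K1\<close> and \<open>K2\<close>.

  Since \<open>h = - \<lambda> G x\<close>, the fractional derivative in each coordinate equals \<open>a G x\<close> with \<open>a\<close>
  between \<open>A = 1 - K1 \<lambda> - K2 \<bar>\<lambda>\<bar>\<close> and \<open>B = 1 - K1 \<lambda> + K2 \<bar>\<lambda>\<bar>\<close>.  On the other hand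
  \<open>G x = \<theta> (x - x\<^sup>*)\<close> with \<open>\<mu> \<le> \<theta> \<le> L\<close>, because \<open>G\<close> vanishes at the coordinate of the
  minimizer.  One step therefore multiplies each coordinate of the error by \<open>1 - z\<close>, where
  \<open>z = \<eta> a \<theta>\<close>.  The choice of \<open>\<eta>\<close> puts \<open>z\<close> between \<open>\<phi> (A / B)\<^sup>2 \<mu> / L\<close> and \<open>\<phi>\<close>, whence
  \<open>(1 - z)\<^sup>2 = 1 - z (2 - z) \<le> 1 - (2 - \<phi>) \<phi> (A / B)\<^sup>2 \<mu> / L\<close>.  Summing the squares over the
  coordinates gives the claim.
\<close>

section \<open>The Caputo operator as an integral over the unit interval\<close>

lemma has_bochner_integral_unit_powr:
  fixes a :: real
  assumes "- 1 < a"
  shows "has_bochner_integral lborel (\<lambda>u. indicator {0<..<1} u * u powr a) (1 / (a + 1))"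
proof (rule has_bochner_integral_nn_integral)
  have "((\<lambda>u. u powr a) has_integral 1 / (a + 1)) {0..1}"
    using has_integral_powr_from_0[OF assms, of 1] by simp
  then have "((\<lambda>u. u powr a) has_integral 1 / (a + 1)) {0<..<1}"
    by (simp add: has_integral_Icc_iff_Ioo)
  then have "((\<lambda>u. indicator {0<..<1} u * u powr a) has_integral 1 / (a + 1)) UNIV"
    by (subst (asm) has_integral_restrict_UNIV[symmetric])
      (simp add: indicator_def of_bool_def if_distrib[of "\<lambda>v. v * _"] cong: if_cong)
  then show "(\<integral>\<^sup>+ u. ennreal (indicator {0<..<1} u * u powr a) \<partial>lborel) = ennreal (1 / (a + 1))"
    by (intro nn_integral_has_integral_lborel) auto
qed (use assms in auto)

lemma set_integrable_unit_powr:
  fixes a :: real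
  assumes "- 1 < a"
  shows "set_integrable lborel {0<..<1} (\<lambda>u. u powr a)"
  using has_bochner_integral_unit_powr[OF assms]
  by (auto simp: set_integrable_def has_bochner_integral_iff)

lemma set_integral_unit_powr:
  fixes a :: real
  assumes "- 1 < a"
  shows "(LINT u:{0<..<1}|lborel. u powr a) = 1 / (a + 1)"
  using has_bochner_integral_unit_powr[OF assms]
  by (auto simp: set_lebesgue_integral_def has_bochner_integral_iff)

lemma set_integrable_unit_powr_bound:
  fixes F :: "real \<Rightarrow> real"
  assumes "- 1 < a" and "F \<in> borel_measurable borel"
    and bound: "\<And>u. 0 < u \<Longrightarrow> u < 1 \<Longrightarrow> \<bar>F u\<bar> \<le> D * u powr a"
  shows "set_integrable lborel {0<..<1} F"
proof (rule set_integrable_bound)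
  show "set_integrable lborel {0<..<1} (\<lambda>u. D * u powr a)"
    by (intro set_integrable_mult_right set_integrable_unit_powr assms)
  show "set_borel_measurable lborel {0<..<1} F"
    using assms(2) unfolding set_borel_measurable_def by measurable
  show "AE u in lborel. u \<in> {0<..<1} \<longrightarrow> norm (F u) \<le> norm (D * u powr a)"
    using bound by (auto intro!: AE_I2 order_trans[OF bound])
qed

lemma abs_set_integral_unit_powr_le:
  fixes F :: "real \<Rightarrow> real"
  assumes "- 1 < a" and "F \<in> borel_measurable borel"
    and bound: "\<And>u. 0 < u \<Longrightarrow> u < 1 \<Longrightarrow> \<bar>F u\<bar> \<le> D * u powr a"
  shows "\<bar>LINT u:{0<..<1}|lborel. F u\<bar> \<le> D / (a + 1)"
proof -
  have F: "set_integrable lborel {0<..<1} F"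
    using assms by (rule set_integrable_unit_powr_bound)
  have D: "set_integrable lborel {0<..<1} (\<lambda>u. D * u powr a)"
    by (intro set_integrable_mult_right set_integrable_unit_powr assms)
  have "\<bar>LINT u:{0<..<1}|lborel. F u\<bar> \<le> (LINT u:{0<..<1}|lborel. \<bar>F u\<bar>)"
    using set_integral_norm_bound[OF F] by simp
  also have "\<dots> \<le> (LINT u:{0<..<1}|lborel. D * u powr a)"
    using bound by (intro set_integral_mono set_integrable_abs F D) auto
  also have "\<dots> = D / (a + 1)"
    using set_integral_unit_powr[OF assms(1)] by simp
  finally show ?thesis .
qed

text \<open>
  The affine substitution absorbs the orientation: for \<open>x < c\<close> the factor \<open>x - c\<close> is negative,
  as is the oriented integral of a positive function.
\<close>

lemma interval_integral_unit_subst: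
  fixes F :: "real \<Rightarrow> real"
  assumes "x \<noteq> c"
  shows "(LBINT t=ereal c..ereal x. F t) =
    (x - c) * (LINT u:{0<..<1}|lborel. F (x - (x - c) * u))"
proof -
  have *: "(LINT t:I|lborel. F t) = \<bar>x - c\<bar> * (LINT u:{0<..<1}|lborel. F (x - (x - c) * u))"
    if I: "\<And>u. x - (x - c) * u \<in> I \<longleftrightarrow> 0 < u \<and> u < 1" for I
  proof -
    have "(LINT t:I|lborel. F t) = \<bar>c - x\<bar> *\<^sub>R
        (LINT u|lborel. indicator I (x + (c - x) * u) *\<^sub>R F (x + (c - x) * u))"
      unfolding set_lebesgue_integral_def using assms
      by (intro lborel_integral_real_affine) auto
    also have "(\<lambda>u. indicator I (x + (c - x) * u) *\<^sub>R F (x + (c - x) * u)) =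
        (\<lambda>u. indicator {0<..<1} u *\<^sub>R F (x - (x - c) * u))"
      using I by (auto simp: indicator_def fun_eq_iff algebra_simps)
    finally show ?thesis
      by (simp add: set_lebesgue_integral_def abs_minus_commute)
  qed
  show ?thesis
  proof (cases "c < x")
    case True
    have "x - (x - c) * u \<in> {c<..<x} \<longleftrightarrow> 0 < u \<and> u < 1" for u
    proof -
      have "x - (x - c) * u > c \<longleftrightarrow> (x - c) * (1 - u) > 0" by (simp add: algebra_simps)
      then show ?thesis using True by (auto simp: zero_less_mult_iff)
    qed
    from *[OF this] True show ?thesis
      by (simp add: interval_lebesgue_integral_def)
  next
    case False
    then have "x < c" using assms by simp
    have "x - (x - c) * u \<in> {x<..<c} \<longleftrightarrow> 0 < u \<and> u < 1" for u
    proof -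
      have "x - (x - c) * u < c \<longleftrightarrow> (x - c) * (1 - u) < 0" by (simp add: algebra_simps)
      then show ?thesis using \<open>x < c\<close> by (auto simp: mult_less_0_iff)
    qed
    from *[OF this] \<open>x < c\<close> show ?thesis
      by (simp add: interval_lebesgue_integral_def left_diff_distrib)
  qed
qed

text \<open>
  The same formula holds at \<open>c = x\<close>, where both sides are \<open>G x\<close>.  So the limiting case needs no
  separate treatment in later estimates.
\<close>

lemma caputo_delta_unit_integral:
  fixes g G G' :: "real \<Rightarrow> real"
  assumes \<alpha>: "0 < \<alpha>" "\<alpha> < 1"
    and g: "\<And>t. (g has_real_derivative G t) (at t)"
    and G: "\<And>t. (G has_real_derivative G' t) (at t)"
  shows "caputo_delta \<alpha> \<beta> c g x = (1 - \<alpha>) *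
    ((LINT u:{0<..<1}|lborel. G (x - (x - c) * u) * u powr (- \<alpha>)) +
     \<beta> * (x - c) * (LINT u:{0<..<1}|lborel. G' (x - (x - c) * u) * u powr (- \<alpha>)))"
    (is "_ = (1 - \<alpha>) * (?I G + \<beta> * (x - c) * ?I G')")
proof -
  have dg: "deriv g = G" and dG: "deriv G = G'"
    using g G by (auto intro!: ext DERIV_imp_deriv)
  show ?thesis
  proof (cases "c = x")
    case True
    have "(LINT u:{0<..<1}|lborel. u powr (- \<alpha>)) = 1 / (1 - \<alpha>)"
      using set_integral_unit_powr[of "- \<alpha>"] \<alpha> by simp
    then show ?thesis using True \<alpha> by (simp add: caputo_delta_def dg)
  next
    case False
    define h where "h = x - c"
    have h: "h \<noteq> 0" using False by (simp add: h_def)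
    have n: "nat \<lceil>\<alpha>\<rceil> = Suc 0" "nat \<lceil>1 + \<alpha>\<rceil> = Suc (Suc 0)"
    proof -
      have "\<lceil>\<alpha>\<rceil> = 1" "\<lceil>1 + \<alpha>\<rceil> = 2" using \<alpha> by (auto simp: ceiling_eq_iff)
      then show "nat \<lceil>\<alpha>\<rceil> = Suc 0" "nat \<lceil>1 + \<alpha>\<rceil> = Suc (Suc 0)" by auto
    qed
    have int: "(LBINT t=ereal c..ereal x. F t / \<bar>x - t\<bar> powr \<alpha>) =
        h * \<bar>h\<bar> powr (- \<alpha>) * ?I F" for F :: "real \<Rightarrow> real"
    proof -
      have "(LBINT t=ereal c..ereal x. F t / \<bar>x - t\<bar> powr \<alpha>) =
          h * (LINT u:{0<..<1}|lborel. F (x - h * u) / \<bar>x - (x - h * u)\<bar> powr \<alpha>)"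
        using interval_integral_unit_subst[of x c] False unfolding h_def by simp
      also have "(LINT u:{0<..<1}|lborel. F (x - h * u) / \<bar>x - (x - h * u)\<bar> powr \<alpha>) =
          (LINT u:{0<..<1}|lborel. \<bar>h\<bar> powr (- \<alpha>) * (F (x - h * u) * u powr (- \<alpha>)))"
        by (intro set_lebesgue_integral_cong)
          (auto simp: abs_mult powr_mult powr_minus field_simps)
      finally show ?thesis by (simp add: h_def)
    qed
    have Gamma: "Gamma (2 - \<alpha>) = (1 - \<alpha>) * Gamma (1 - \<alpha>)" "Gamma (1 - \<alpha>) \<noteq> 0"
    proof -
      show "Gamma (2 - \<alpha>) = (1 - \<alpha>) * Gamma (1 - \<alpha>)"
        using Gamma_plus1[of "1 - \<alpha>"] \<alpha> nonpos_Ints_nonpos[of "1 - \<alpha>"] by force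
      show "Gamma (1 - \<alpha>) \<noteq> 0" 
        using nonpos_Ints_nonpos[of "1 - \<alpha>"] \<alpha> by (force simp: Gamma_eq_zero_iff)
    qed
    have D1: "caputo_deriv \<alpha> c g x = 1 / Gamma (1 - \<alpha>) * (h * \<bar>h\<bar> powr (- \<alpha>) * ?I G)"
      using int[of G] by (simp add: caputo_deriv_def n dg)
    have D2: "caputo_deriv (1 + \<alpha>) c g x =
        sgn h / Gamma (1 - \<alpha>) * (h * \<bar>h\<bar> powr (- \<alpha>) * ?I G')"
      using int[of G'] by (simp add: caputo_deriv_def n dg dG h_def)
    have "caputo_delta \<alpha> \<beta> c g x = Gamma (2 - \<alpha>) * \<bar>h\<bar> powr \<alpha> / h *
        (1 / Gamma (1 - \<alpha>) * (h * \<bar>h\<bar> powr (- \<alpha>) * ?I G) +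
         \<beta> * \<bar>h\<bar> * (sgn h / Gamma (1 - \<alpha>) * (h * \<bar>h\<bar> powr (- \<alpha>) * ?I G')))"
      using False by (simp add: caputo_delta_def D1 D2 h_def)
    also have "\<dots> = (1 - \<alpha>) * (\<bar>h\<bar> powr \<alpha> * \<bar>h\<bar> powr (- \<alpha>)) *
        (?I G + \<beta> * (\<bar>h\<bar> * sgn h) * ?I G')"
      using h Gamma(2) by (simp add: Gamma(1) field_simps)
    also have "\<bar>h\<bar> powr \<alpha> * \<bar>h\<bar> powr (- \<alpha>) = 1"
      using h by (simp add: powr_minus)
    also have "\<bar>h\<bar> * sgn h = h" by (rule abs_mult_sgn)
    finally show ?thesis by (simp add: h_def)
  qed
qed

section \<open>Comparison with the ordinary derivative\<close>

text \<open>
  A derivative may be discontinuous, but it is the pointwise limit of difference quotients of a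
  continuous function.
\<close>

lemma borel_measurable_has_real_derivative:
  fixes G G' :: "real \<Rightarrow> real"
  assumes G: "\<And>t. (G has_real_derivative G' t) (at t)"
  shows "G' \<in> borel_measurable borel"
proof (rule borel_measurable_LIMSEQ_real)
  have "continuous_on UNIV G"
    using G by (auto intro!: continuous_at_imp_continuous_on DERIV_isCont)
  then have [measurable]: "G \<in> borel_measurable borel"
    by (rule borel_measurable_continuous_onI)
  show "(\<lambda>t. (G (t + inverse (real (Suc n))) - G t) / inverse (real (Suc n)))
      \<in> borel_measurable borel" for n
    by measurable
  fix t
  have "((\<lambda>h. (G (t + h) - G t) / h) \<longlongrightarrow> G' t) (at 0)"
    using G[of t] by (simp add: DERIV_def)
  moreover have "filterlim (\<lambda>n. inverse (real (Suc n))) (at 0) sequentially"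
    using LIMSEQ_inverse_real_of_nat by (auto simp: filterlim_at)
  ultimately show "(\<lambda>n. (G (t + inverse (real (Suc n))) - G t) / inverse (real (Suc n)))
      \<longlonglongrightarrow> G' t"
    by (rule filterlim_compose)
qed

lemma abs_linearization_error_le:
  fixes G G' :: "real \<Rightarrow> real"
  assumes G: "\<And>t. (G has_real_derivative G' t) (at t)"
    and d: "\<And>t. \<bar>G' t - m\<bar> \<le> d"
  shows "\<bar>G y - G x - m * (y - x)\<bar> \<le> d * \<bar>y - x\<bar>"
proof -
  have "((\<lambda>t. G t - m * t) has_real_derivative G' t - m) (at t within UNIV)" for t
    by (auto intro!: derivative_eq_intros G)
  then have "norm ((G y - m * y) - (G x - m * x)) \<le> d * norm (y - x)"
    by (rule field_differentiable_bound[of UNIV, OF convex_UNIV]) (use d in auto)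
  then show ?thesis by (simp add: algebra_simps)
qed

text \<open>
  For constant second derivative \<open>m\<close> the operator equals \<open>G x + (x - c) m (\<beta> - \<gamma>)\<close>, where
  \<open>\<gamma> = (1 - \<alpha>) / (2 - \<alpha>)\<close> is the mean of \<open>u\<close> under the probability density
  \<open>(1 - \<alpha>) u\<^sup>-\<^sup>\<alpha>\<close>.  The error is estimated separately in the first- and second-order terms.
\<close>

lemma caputo_delta_approx:
  fixes g G G' :: "real \<Rightarrow> real"
  assumes \<alpha>: "0 < \<alpha>" "\<alpha> < 1"
    and g: "\<And>t. (g has_real_derivative G t) (at t)"
    and G: "\<And>t. (G has_real_derivative G' t) (at t)"
    and d: "\<And>t. \<bar>G' t - m\<bar> \<le> d"
    and \<gamma>: "\<gamma> = (1 - \<alpha>) / (2 - \<alpha>)"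
  shows "\<bar>caputo_delta \<alpha> \<beta> c g x - (G x + (x - c) * (m * (\<beta> - \<gamma>)))\<bar>
    \<le> \<bar>x - c\<bar> * (d * (\<bar>\<beta>\<bar> + \<gamma>))"
proof -
  define h where "h = x - c"
  define E1 where "E1 u = (G (x - h * u) - G x + m * h * u) * u powr (- \<alpha>)" for u
  define E2 where "E2 u = (G' (x - h * u) - m) * u powr (- \<alpha>)" for u
  have "continuous_on UNIV G"
    using G by (auto intro!: continuous_at_imp_continuous_on DERIV_isCont)
  then have [measurable]: "G \<in> borel_measurable borel"
    by (rule borel_measurable_continuous_onI)
  have [measurable]: "G' \<in> borel_measurable borel"
    using G by (rule borel_measurable_has_real_derivative)
  have E [measurable]: "E1 \<in> borel_measurable borel" "E2 \<in> borel_measurable borel"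
    unfolding E1_def E2_def by measurable
  have b1: "\<bar>E1 u\<bar> \<le> d * \<bar>h\<bar> * u powr (1 - \<alpha>)" if "0 < u" for u
  proof -
    have "\<bar>G (x - h * u) - G x + m * h * u\<bar> \<le> d * \<bar>h\<bar> * u"
      using abs_linearization_error_le[OF G d, of "x - h * u" x] that
      by (simp add: abs_mult algebra_simps)
    then have "\<bar>E1 u\<bar> \<le> d * \<bar>h\<bar> * u * u powr (- \<alpha>)"
      unfolding E1_def by (simp add: abs_mult mult_right_mono)
    also have "\<dots> = d * \<bar>h\<bar> * u powr (1 - \<alpha>)"
      using that by (simp add: powr_diff powr_minus field_simps)
    finally show ?thesis .
  qed
  have b2: "\<bar>E2 u\<bar> \<le> d * u powr (- \<alpha>)" if "0 < u" for u
    unfolding E2_def using d by (simp add: abs_mult mult_right_mono)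
  have iE1: "set_integrable lborel {0<..<1} E1"
    using \<alpha> b1 by (intro set_integrable_unit_powr_bound[where a="1 - \<alpha>"]) auto
  have iE2: "set_integrable lborel {0<..<1} E2"
    using \<alpha> b2 by (intro set_integrable_unit_powr_bound[where a="- \<alpha>"]) auto
  have E1_le: "\<bar>LINT u:{0<..<1}|lborel. E1 u\<bar> \<le> d * \<bar>h\<bar> / (2 - \<alpha>)"
    using abs_set_integral_unit_powr_le[OF _ E(1) b1] \<alpha> by simp
  have E2_le: "\<bar>LINT u:{0<..<1}|lborel. E2 u\<bar> \<le> d / (1 - \<alpha>)"
    using abs_set_integral_unit_powr_le[OF _ E(2) b2] \<alpha> by simp
  have w0: "set_integrable lborel {0<..<1} (\<lambda>u. u powr (- \<alpha>))"
      "(LINT u:{0<..<1}|lborel. u powr (- \<alpha>)) = 1 / (1 - \<alpha>)"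
    using set_integrable_unit_powr[of "- \<alpha>"] set_integral_unit_powr[of "- \<alpha>"] \<alpha> by auto
  have w1: "set_integrable lborel {0<..<1} (\<lambda>u. u powr (1 - \<alpha>))"
      "(LINT u:{0<..<1}|lborel. u powr (1 - \<alpha>)) = 1 / (2 - \<alpha>)"
    using set_integrable_unit_powr[of "1 - \<alpha>"] set_integral_unit_powr[of "1 - \<alpha>"] \<alpha> by auto
  have "(LINT u:{0<..<1}|lborel. G (x - h * u) * u powr (- \<alpha>)) =
      (LINT u:{0<..<1}|lborel. (G x * u powr (- \<alpha>) - m * h * u powr (1 - \<alpha>)) + E1 u)"
    by (intro set_lebesgue_integral_cong)
      (auto simp: E1_def powr_diff powr_minus field_simps)
  also have "\<dots> = G x / (1 - \<alpha>) - m * h / (2 - \<alpha>) + (LINT u:{0<..<1}|lborel. E1 u)"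
    using w0 w1 iE1 by simp
  finally have I1: "(LINT u:{0<..<1}|lborel. G (x - h * u) * u powr (- \<alpha>)) =
      G x / (1 - \<alpha>) - m * h / (2 - \<alpha>) + (LINT u:{0<..<1}|lborel. E1 u)" .
  have "(LINT u:{0<..<1}|lborel. G' (x - h * u) * u powr (- \<alpha>)) =
      (LINT u:{0<..<1}|lborel. m * u powr (- \<alpha>) + E2 u)"
    by (intro set_lebesgue_integral_cong) (auto simp: E2_def algebra_simps)
  also have "\<dots> = m / (1 - \<alpha>) + (LINT u:{0<..<1}|lborel. E2 u)"
    using w0 iE2 by simp
  finally have I2: "(LINT u:{0<..<1}|lborel. G' (x - h * u) * u powr (- \<alpha>)) =
      m / (1 - \<alpha>) + (LINT u:{0<..<1}|lborel. E2 u)" .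
  \<comment> \<open>The denominators \<open>1 - \<alpha>\<close> and \<open>2 - \<alpha>\<close> are kept as atoms \<open>P\<close> and \<open>Q\<close>, so that they cancel
     before anything is multiplied out.\<close>
  have collect: "P * ((p / P - m * h / Q + I) + \<beta> * h * (m / P + J)) -
      (p + h * (m * (\<beta> - P / Q))) = P * I + \<beta> * h * (P * J)"
    if "P \<noteq> 0" "Q \<noteq> 0" for P Q p I J :: real
    using that by (simp add: field_simps)
  have "caputo_delta \<alpha> \<beta> c g x - (G x + h * (m * (\<beta> - \<gamma>))) =
      (1 - \<alpha>) * (LINT u:{0<..<1}|lborel. E1 u) +
      \<beta> * h * ((1 - \<alpha>) * (LINT u:{0<..<1}|lborel. E2 u))"
    unfolding caputo_delta_unit_integral[OF \<alpha> g G] h_def[symmetric] I1 I2 \<gamma>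
    using \<alpha> by (intro collect) auto
  also have "\<bar>\<dots>\<bar> \<le> (1 - \<alpha>) * \<bar>LINT u:{0<..<1}|lborel. E1 u\<bar> +
      \<bar>\<beta>\<bar> * \<bar>h\<bar> * ((1 - \<alpha>) * \<bar>LINT u:{0<..<1}|lborel. E2 u\<bar>)"
    using \<alpha> by (intro order_trans[OF abs_triangle_ineq]) (simp add: abs_mult)
  also have "\<dots> \<le> (1 - \<alpha>) * (d * \<bar>h\<bar> / (2 - \<alpha>)) +
      \<bar>\<beta>\<bar> * \<bar>h\<bar> * ((1 - \<alpha>) * (d / (1 - \<alpha>)))"
    using \<alpha> by (intro add_mono mult_left_mono E1_le E2_le) auto
  also have "\<dots> = \<bar>h\<bar> * (d * (\<bar>\<beta>\<bar> + \<gamma>))"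
    unfolding \<gamma> using \<alpha> by (simp add: distrib_left mult_ac)
  finally show ?thesis by (simp add: h_def)
qed

section \<open>Smoothness and strong convexity on a coordinate line\<close>

text \<open>Adding each quadratic bound to the one with the two points exchanged cancels the values of \<open>g\<close>.\<close>

lemma gradient_increment_bounds:
  fixes g G :: "real \<Rightarrow> real"
  assumes "\<And>y z. \<mu> / 2 * (z - y)\<^sup>2 \<le> g z - g y - G y * (z - y)"
    and "\<And>y z. g z - g y - G y * (z - y) \<le> L / 2 * (z - y)\<^sup>2"
  shows "\<mu> * (z - y)\<^sup>2 \<le> (G z - G y) * (z - y)"
    and "(G z - G y) * (z - y) \<le> L * (z - y)\<^sup>2"
  using assms(1)[of z y] assms(1)[of y z] assms(2)[of z y] assms(2)[of y z]
  by (auto simp: algebra_simps power2_eq_square)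

lemma derivative_bounds_of_increment_bounds:
  fixes G :: "real \<Rightarrow> real"
  assumes lo: "\<And>y z. \<mu> * (z - y)\<^sup>2 \<le> (G z - G y) * (z - y)"
    and up: "\<And>y z. (G z - G y) * (z - y) \<le> L * (z - y)\<^sup>2"
    and D: "(G has_real_derivative D) (at t)"
  shows "\<mu> \<le> D" and "D \<le> L"
proof -
  have lim: "((\<lambda>y. (G y - G t) / (y - t)) \<longlongrightarrow> D) (at t)"
    using D by (simp add: has_field_derivative_iff)
  have q: "(G y - G t) / (y - t) = (G y - G t) * (y - t) / (y - t)\<^sup>2" if "y \<noteq> t" for y
    using that by (simp add: power2_eq_square)
  have ev: "eventually (\<lambda>y. y \<noteq> t) (at t)"
    by (simp add: eventually_at_filter)
  show "\<mu> \<le> D"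
  proof (rule tendsto_lowerbound[OF lim])
    show "eventually (\<lambda>y. \<mu> \<le> (G y - G t) / (y - t)) (at t)"
      using ev by eventually_elim (use q lo in \<open>simp add: pos_le_divide_eq\<close>)
  qed simp
  show "D \<le> L"
  proof (rule tendsto_upperbound[OF lim])
    show "eventually (\<lambda>y. (G y - G t) / (y - t) \<le> L) (at t)"
      using ev by eventually_elim (use q up in \<open>simp add: pos_divide_le_eq\<close>)
  qed simp
qed

lemma GDERIV_grad:
  assumes "f differentiable (at x)"
  shows "GDERIV f x :> grad f x"
proof -
  obtain f' where f': "(f has_derivative f') (at x)"
    using assms by (auto simp: differentiable_def)
  have lin: "linear f'" using f' by (rule has_derivative_linear)
  have "f' h = h \<bullet> (\<Sum>b\<in>Basis. f' b *\<^sub>R b)" for h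
  proof -
    have "f' h = f' (\<Sum>b\<in>Basis. (h \<bullet> b) *\<^sub>R b)"
      by (simp only: euclidean_representation)
    also have "\<dots> = (\<Sum>b\<in>Basis. (h \<bullet> b) * f' b)"
      by (simp only: linear_sum[OF lin] linear_scale[OF lin] real_scaleR_def)
    also have "\<dots> = h \<bullet> (\<Sum>b\<in>Basis. f' b *\<^sub>R b)"
      by (simp only: inner_sum_right inner_scaleR_right mult.commute)
    finally show ?thesis .
  qed
  then have "f' = (\<lambda>h. h \<bullet> (\<Sum>b\<in>Basis. f' b *\<^sub>R b))" by (rule ext)
  with f' have D: "GDERIV f x :> (\<Sum>b\<in>Basis. f' b *\<^sub>R b)"
    unfolding gderiv_def by (rule has_derivative_subst)
  have "E = (\<Sum>b\<in>Basis. f' b *\<^sub>R b)" if "GDERIV f x :> E" for E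
  proof -
    have "(\<lambda>h. h \<bullet> E) = (\<lambda>h. h \<bullet> (\<Sum>b\<in>Basis. f' b *\<^sub>R b))"
      using that D unfolding gderiv_def by (rule has_derivative_unique)
    then have "\<forall>h. h \<bullet> E = h \<bullet> (\<Sum>b\<in>Basis. f' b *\<^sub>R b)" unfolding fun_eq_iff .
    then show ?thesis by (rule iffD1[OF vector_eq_ldot])
  qed
  with D have "\<exists>!E. GDERIV f x :> E" by (rule ex1I)
  then show ?thesis unfolding grad_def by (rule theI')
qed

definition coord_line :: "real ^ 'n \<Rightarrow> 'n \<Rightarrow> real \<Rightarrow> real ^ 'n" where
  "coord_line x j y = x + (y - x $ j) *\<^sub>R axis j 1"

lemma coord_line_nth: "coord_line x j y $ i = (if i = j then y else x $ i)"
  by (simp add: coord_line_def axis_def)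

lemma coord_line_self: "coord_line x j (x $ j) = x"
  by (simp add: coord_line_def)

lemma coord_line_diff: "coord_line x j z - coord_line x j y = (z - y) *\<^sub>R axis j 1"
  by (simp add: coord_line_def algebra_simps)

lemma has_derivative_coord_line:
  "(coord_line x j has_derivative (\<lambda>h. h *\<^sub>R axis j 1)) (at y)"
  unfolding coord_line_def[abs_def] by (auto intro!: derivative_eq_intros)

lemma coord_line_derivatives:
  fixes f :: "real ^ 'n \<Rightarrow> real"
  assumes "twice_differentiable f"
  shows "((\<lambda>y. f (coord_line x j y)) has_real_derivative grad f (coord_line x j y) $ j) (at y)"
    and "(\<lambda>y. grad f (coord_line x j y) $ j) differentiable (at y)"
proof -
  have f: "GDERIV f z :> grad f z" and df: "grad f differentiable (at z)" for z
    using assms by (auto simp: twice_differentiable_def intro: GDERIV_grad)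
  have "((\<lambda>y. f (coord_line x j y)) has_derivative
      (\<lambda>h. (h *\<^sub>R axis j 1) \<bullet> grad f (coord_line x j y))) (at y)"
    by (rule has_derivative_compose[OF has_derivative_coord_line f[unfolded gderiv_def]])
  moreover have "(\<lambda>h. (h *\<^sub>R axis j 1) \<bullet> grad f (coord_line x j y)) =
      (*) (grad f (coord_line x j y) $ j)"
    by (rule ext) (simp add: inner_axis')
  ultimately show "((\<lambda>y. f (coord_line x j y)) has_real_derivative
      grad f (coord_line x j y) $ j) (at y)"
    by (simp only: has_field_derivative_def)
  have "(\<lambda>y. grad f (coord_line x j y)) differentiable (at y)"
    by (rule differentiable_compose[OF df differentiableI[OF has_derivative_coord_line]])
  then obtain D where D: "((\<lambda>y. grad f (coord_line x j y)) has_derivative D) (at y)"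
    unfolding differentiable_def by blast
  show "(\<lambda>y. grad f (coord_line x j y) $ j) differentiable (at y)"
    using bounded_linear.has_derivative[OF bounded_linear_vec_nth D]
    by (rule differentiableI)
qed

lemma coord_line_increment_bounds:
  fixes f :: "real ^ 'n \<Rightarrow> real"
  assumes "L_smooth L f" and "strongly_convex \<mu> f"
  defines "G \<equiv> \<lambda>x j y. grad f (coord_line x j y) $ j"
  shows "\<mu> * (z - y)\<^sup>2 \<le> (G x j z - G x j y) * (z - y)"
    and "(G x j z - G x j y) * (z - y) \<le> L * (z - y)\<^sup>2"
proof -
  let ?p = "coord_line x j"
  have inner: "grad f (?p y) \<bullet> (?p z - ?p y) = G x j y * (z - y)" for y z
    by (simp add: coord_line_diff inner_axis G_def mult.commute)
  have norm: "(norm (?p z - ?p y))\<^sup>2 = (z - y)\<^sup>2" for y z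
    by (simp add: coord_line_diff)
  have lo: "\<mu> / 2 * (z - y)\<^sup>2 \<le> f (?p z) - f (?p y) - G x j y * (z - y)" for y z
    using assms(2) inner[of y z] norm[of z y] unfolding strongly_convex_def by metis
  have up: "f (?p z) - f (?p y) - G x j y * (z - y) \<le> L / 2 * (z - y)\<^sup>2" for y z
    using assms(1) inner[of y z] norm[of z y] unfolding L_smooth_def
    by (metis abs_le_D1)
  show "\<mu> * (z - y)\<^sup>2 \<le> (G x j z - G x j y) * (z - y)"
    and "(G x j z - G x j y) * (z - y) \<le> L * (z - y)\<^sup>2"
    using gradient_increment_bounds[of \<mu> "\<lambda>y. f (?p y)" "G x j" L, OF lo up] by blast+
qed

text \<open>
  For a separable function, the restrictions to two parallel coordinate lines differ by a constant.
  So the \<open>j\<close>-th coordinate of the minimizer minimizes the restriction to every line in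
  direction \<open>j\<close>, not only to the one through the minimizer.
\<close>

lemma separable_grad_at_minimizer:
  fixes f :: "real ^ 'n \<Rightarrow> real" and fi :: "'n \<Rightarrow> real \<Rightarrow> real"
  assumes f: "twice_differentiable f"
    and sep: "\<And>z. f z = (\<Sum>i\<in>UNIV. fi i (z $ i))"
    and min: "\<And>z. f xstar \<le> f z"
  shows "grad f (coord_line x j (xstar $ j)) $ j = 0"
proof (rule DERIV_local_min[OF coord_line_derivatives(1)[OF f]])
  have split: "f (coord_line w j y) = fi j y + (\<Sum>i\<in>UNIV - {j}. fi i (w $ i))" for w y
    unfolding sep by (subst sum.remove[of _ j]) (auto simp: coord_line_nth intro!: sum.cong)
  have "f (coord_line x j (xstar $ j)) \<le> f (coord_line x j y)" for y
    using min[of "coord_line xstar j y"] split[of xstar y] split[of xstar "xstar $ j"]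
      split[of x y] split[of x "xstar $ j"] by (simp add: coord_line_self)
  then show "\<forall>y. \<bar>xstar $ j - y\<bar> < 1 \<longrightarrow> f (coord_line x j (xstar $ j)) \<le> f (coord_line x j y)"
    by blast
qed simp

section \<open>One step of the method\<close>

text \<open>
  Because the offset \<open>s = x - c\<close> is itself proportional to the derivative \<open>p\<close>, the additive error
  of the approximation becomes a relative error, which can be absorbed into the step size.
\<close>

lemma caputo_delta_eq_multiple_of_derivative:
  fixes p D s l K1 K2 :: real
  assumes D: "\<bar>D - (p + s * K1)\<bar> \<le> \<bar>s\<bar> * K2" and s: "s = - (l * p)" and "K2 \<ge> 0"
  obtains a where "D = a * p"
    "1 - K1 * l - K2 * \<bar>l\<bar> \<le> a" "a \<le> 1 - K1 * l + K2 * \<bar>l\<bar>"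
proof (cases "p = 0")
  case True
  show ?thesis
    by (rule that[of "1 - K1 * l"]) (use True D s \<open>K2 \<ge> 0\<close> in auto)
next
  case False
  have "D - (p + s * K1) = (D / p - (1 - K1 * l)) * p"
    using False by (simp add: s field_simps)
  then have "\<bar>D / p - (1 - K1 * l)\<bar> * \<bar>p\<bar> \<le> (K2 * \<bar>l\<bar>) * \<bar>p\<bar>"
    using D by (simp add: s abs_mult mult_ac)
  then have "\<bar>D / p - (1 - K1 * l)\<bar> \<le> K2 * \<bar>l\<bar>"
    using False by simp
  then show ?thesis
    by (intro that[of "D / p"]) (use False in auto)
qed

text \<open>
  The derivative vanishes at the minimizer, so it is the error \<open>h\<close> times an average \<open>\<theta>\<close> of the
  second derivative.
\<close>

lemma derivative_eq_multiple_of_error: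
  fixes p h \<mu> L :: real
  assumes "\<mu> * h\<^sup>2 \<le> p * h" "p * h \<le> L * h\<^sup>2" "h = 0 \<Longrightarrow> p = 0" "\<mu> \<le> L"
  obtains \<theta> where "p = \<theta> * h" "\<mu> \<le> \<theta>" "\<theta> \<le> L"
proof (cases "h = 0")
  case True
  show ?thesis by (rule that[of \<mu>]) (use True assms in auto)
next
  case False
  have "p * h = p / h * h\<^sup>2" and "0 < h\<^sup>2"
    using False by (auto simp: power2_eq_square zero_less_mult_iff)
  then have "\<mu> \<le> p / h" "p / h \<le> L"
    using assms(1,2) by (metis mult_le_cancel_right_pos)+
  then show ?thesis
    by (intro that[of "p / h"]) (use False in auto)
qed

lemma step_contraction:
  fixes A B L \<mu> \<phi> a \<theta> \<eta> :: real
  assumes "0 < A" "A \<le> B" "0 < \<mu>" "\<mu> \<le> \<theta>" "\<theta> \<le> L" "0 < \<phi>" "\<phi> < 2" "A \<le> a" "a \<le> B"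
    and \<eta>: "\<eta> = A * \<phi> / (B\<^sup>2 * L)"
  shows "(1 - \<eta> * a * \<theta>)\<^sup>2 \<le> 1 - (2 - \<phi>) * \<phi> * (\<mu> / L) * (A / B)\<^sup>2"
proof -
  let ?z = "\<eta> * a * \<theta>"
  have pos: "0 < B" "0 < L" "0 < a" "0 < \<theta>" "\<eta> > 0" using assms by auto
  have "\<eta> * A * \<mu> \<le> ?z"
    using assms pos by (intro mult_mono) auto
  moreover have "\<eta> * A * \<mu> = \<phi> * (\<mu> / L) * (A / B)\<^sup>2"
    by (simp add: \<eta> power2_eq_square mult_ac)
  ultimately have lo: "\<phi> * (\<mu> / L) * (A / B)\<^sup>2 \<le> ?z" by simp
  have "?z \<le> \<eta> * B * L"
    using assms pos by (intro mult_mono) auto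
  also have "\<dots> = \<phi> * (A / B)"
    using pos by (simp add: \<eta> power2_eq_square)
  also have "\<dots> \<le> \<phi>" using assms pos by (intro mult_left_le) auto
  finally have up: "?z \<le> \<phi>" .
  have "(2 - \<phi>) * (\<phi> * (\<mu> / L) * (A / B)\<^sup>2) \<le> (2 - ?z) * ?z"
    by (rule mult_mono) (use lo up assms pos in auto)
  then have "1 - (2 - ?z) * ?z \<le> 1 - (2 - \<phi>) * \<phi> * (\<mu> / L) * (A / B)\<^sup>2"
    by (simp only: mult.assoc diff_left_mono)
  moreover have "(1 - z)\<^sup>2 = 1 - (2 - z) * z" for z :: real
    by (simp add: power2_eq_square algebra_simps)
  ultimately show ?thesis by simp
qed

lemma rate_le_gradient_descent:
  fixes A B L \<mu> \<phi> :: real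
  assumes "0 < A" "A \<le> B" "0 < \<mu>" "0 < L" "0 < \<phi>" "\<phi> < 2"
  shows "(2 - \<phi>) * \<phi> * (\<mu> / L) * (A / B)\<^sup>2 \<le> \<mu> / L"
proof -
  have "(\<phi> - 1)\<^sup>2 \<ge> 0" by simp
  then have "(2 - \<phi>) * \<phi> \<le> 1" by (simp add: power2_eq_square algebra_simps)
  moreover have "(A / B)\<^sup>2 \<le> 1" using assms by (intro power_le_one) auto
  ultimately have "((2 - \<phi>) * \<phi>) * (A / B)\<^sup>2 \<le> 1"
    using assms by (intro mult_le_one[of "(2 - \<phi>) * \<phi>"]) auto
  then have "((2 - \<phi>) * \<phi>) * (A / B)\<^sup>2 * (\<mu> / L) \<le> 1 * (\<mu> / L)"
    using assms by (intro mult_right_mono) auto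
  then show ?thesis by (simp add: mult_ac)
qed

theorem corollary4p5:
  fixes f :: "real ^ 'n \<Rightarrow> real"
    and fi :: "'n \<Rightarrow> real \<Rightarrow> real"
    and L \<mu> \<alpha> \<beta> \<gamma> K1 K2 \<phi> \<epsilon> :: real
    and l \<eta> :: "nat \<Rightarrow> real"
    and x c :: "nat \<Rightarrow> real ^ 'n"
    and xstar :: "real ^ 'n"
  assumes "L > 0" and "\<mu> > 0"
    and "twice_differentiable f"
    and "L_smooth L f"
    and "strongly_convex \<mu> f"
    and "\<forall>z. f z = (\<Sum>i\<in>UNIV. fi i (z $ i))"
    and "is_arg_min f (\<lambda>z. True) xstar"
    and "0 < \<alpha>" and "\<alpha> < 1"
    and "\<gamma> = (1 - \<alpha>) / (2 - \<alpha>)"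
    and "K1 = (L + \<mu>) / 2 * (\<beta> - \<gamma>)"
    and "K2 = (if \<beta> \<ge> 0 then (L - \<mu>) / 2 * (\<beta> + \<gamma>) else (\<mu> - L) / 2 * (\<beta> - \<gamma>))"
    and "0 < \<phi>" and "\<phi> < 2"
    and "\<epsilon> > 0"
    and "\<forall>t. 1 - K1 * l t - K2 * \<bar>l t\<bar> > \<epsilon>"
    and "\<forall>t. \<eta> t = (1 - K1 * l t - K2 * \<bar>l t\<bar>) * \<phi> / ((1 - K1 * l t + K2 * \<bar>l t\<bar>)\<^sup>2 * L)"
    and "\<forall>t. x t - c t = - (l t *\<^sub>R grad f (x t))"
    and "\<forall>t. x (Suc t) = x t - \<eta> t *\<^sub>R caputo_grad \<alpha> \<beta> (c t) f (x t)"
  shows "\<forall>t. (norm (x (Suc t) - xstar))\<^sup>2 \<le>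
               (1 - (2 - \<phi>) * \<phi> * (\<mu> / L) *
                 ((1 - K1 * l t - K2 * \<bar>l t\<bar>) / (1 - K1 * l t + K2 * \<bar>l t\<bar>))\<^sup>2)
               * (norm (x t - xstar))\<^sup>2
           \<and> 1 - (2 - \<phi>) * \<phi> * (\<mu> / L) *
                 ((1 - K1 * l t - K2 * \<bar>l t\<bar>) / (1 - K1 * l t + K2 * \<bar>l t\<bar>))\<^sup>2
               \<ge> 1 - \<mu> / L"
proof -
  have f: "twice_differentiable f" and smooth: "L_smooth L f" and convex: "strongly_convex \<mu> f"
    and \<alpha>: "0 < \<alpha>" "\<alpha> < 1"
    using assms by auto
  have min: "f xstar \<le> f z" for z
    using assms(7) by (auto simp: is_arg_min_def not_less)
  define G where "G x j y = grad f (coord_line x j y) $ j" for x j y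
  have inc: "\<mu> * (z - y)\<^sup>2 \<le> (G x j z - G x j y) * (z - y)"
      "(G x j z - G x j y) * (z - y) \<le> L * (z - y)\<^sup>2" for x j y z
    using coord_line_increment_bounds[OF smooth convex] unfolding G_def by blast+
  have dG: "(G x j has_real_derivative deriv (G x j) y) (at y)" for x j y
    using coord_line_derivatives(2)[OF f, of x j y]
    unfolding G_def[abs_def] by (simp add: DERIV_deriv_iff_real_differentiable)
  have "\<mu> \<le> L"
    using derivative_bounds_of_increment_bounds[OF inc dG] by (rule order_trans)
  have "\<gamma> \<ge> 0" using assms(10) \<alpha> by simp
  have K2: "K2 = (L - \<mu>) / 2 * (\<bar>\<beta>\<bar> + \<gamma>)"
    using assms(12) by (auto simp: field_simps)
  have "K2 \<ge> 0" unfolding K2 using \<open>\<mu> \<le> L\<close> \<open>\<gamma> \<ge> 0\<close> by simp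
  have delta: "\<bar>caputo_grad \<alpha> \<beta> c f x $ j - (grad f x $ j + (x $ j - c $ j) * K1)\<bar>
      \<le> \<bar>x $ j - c $ j\<bar> * K2" for c x j
  proof -
    have "\<bar>deriv (G x j) y - (L + \<mu>) / 2\<bar> \<le> (L - \<mu>) / 2" for y
      using derivative_bounds_of_increment_bounds[OF inc dG, of x j y]
      by (simp add: abs_le_iff field_simps)
    moreover have "((\<lambda>y. f (coord_line x j y)) has_real_derivative G x j y) (at y)" for y
      unfolding G_def by (rule coord_line_derivatives(1)[OF f])
    ultimately have "\<bar>caputo_delta \<alpha> \<beta> (c $ j) (\<lambda>y. f (coord_line x j y)) (x $ j) -
        (G x j (x $ j) + (x $ j - c $ j) * ((L + \<mu>) / 2 * (\<beta> - \<gamma>)))\<bar>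
        \<le> \<bar>x $ j - c $ j\<bar> * ((L - \<mu>) / 2 * (\<bar>\<beta>\<bar> + \<gamma>))"
      by (intro caputo_delta_approx[OF \<alpha> _ dG _ assms(10)])
    then show ?thesis
      by (simp add: caputo_grad_def coord_line_def[symmetric] G_def coord_line_self K2 assms(11))
  qed
  show ?thesis
  proof (rule allI, rule conjI)
    fix t
    define A where "A = 1 - K1 * l t - K2 * \<bar>l t\<bar>"
    define B where "B = 1 - K1 * l t + K2 * \<bar>l t\<bar>"
    define q where "q = 1 - (2 - \<phi>) * \<phi> * (\<mu> / L) * (A / B)\<^sup>2"
    have A: "0 < A" using assms(15,16) unfolding A_def by (meson less_trans)
    have AB: "A \<le> B"
    proof -
      have "0 \<le> K2 * \<bar>l t\<bar>" using \<open>K2 \<ge> 0\<close> by simp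
      then show ?thesis unfolding A_def B_def by linarith
    qed
    have \<eta>: "\<eta> t = A * \<phi> / (B\<^sup>2 * L)" using assms(17) by (simp add: A_def B_def)
    have coord: "(x (Suc t) $ j - xstar $ j)\<^sup>2 \<le> q * (x t $ j - xstar $ j)\<^sup>2" for j
    proof -
      let ?h = "x t $ j - xstar $ j" and ?p = "grad f (x t) $ j"
      have "x t $ j - c t $ j = - (l t * ?p)"
        using arg_cong[OF spec[OF assms(18), of t], of "\<lambda>v. v $ j"] by simp
      from caputo_delta_eq_multiple_of_derivative[OF delta this \<open>K2 \<ge> 0\<close>]
      obtain a where a: "caputo_grad \<alpha> \<beta> (c t) f (x t) $ j = a * ?p" "A \<le> a" "a \<le> B"
        unfolding A_def B_def by metis
      have G0: "G (x t) j (xstar $ j) = 0"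
        unfolding G_def by (rule separable_grad_at_minimizer[OF f assms(6)[rule_format] min])
      have Gp: "G (x t) j (x t $ j) = ?p"
        by (simp add: G_def coord_line_self)
      have "\<mu> * ?h\<^sup>2 \<le> ?p * ?h" "?p * ?h \<le> L * ?h\<^sup>2"
        using inc[where z="x t $ j" and y="xstar $ j" and x="x t" and j=j] by (simp_all add: G0 Gp)
      moreover have "?p = 0" if "?h = 0" using that G0 Gp by simp
      ultimately obtain \<theta> where \<theta>: "?p = \<theta> * ?h" "\<mu> \<le> \<theta>" "\<theta> \<le> L"
        using \<open>\<mu> \<le> L\<close> by (rule derivative_eq_multiple_of_error)
      have "x (Suc t) $ j - xstar $ j = ?h - \<eta> t * (a * ?p)"
        using assms(19) a(1) by simp
      also have "\<dots> = (1 - \<eta> t * a * \<theta>) * ?h"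
        by (simp add: \<theta>(1) algebra_simps)
      finally have "(x (Suc t) $ j - xstar $ j)\<^sup>2 = (1 - \<eta> t * a * \<theta>)\<^sup>2 * ?h\<^sup>2"
        by (simp add: power_mult_distrib)
      also have "\<dots> \<le> q * ?h\<^sup>2"
        unfolding q_def
        by (intro mult_right_mono
            step_contraction[OF A AB assms(2) \<theta>(2,3) assms(13,14) a(2,3) \<eta>]) simp
      finally show ?thesis .
    qed
    have norm2: "(norm v)\<^sup>2 = (\<Sum>j\<in>UNIV. (v $ j)\<^sup>2)" for v :: "real ^ 'n"
      by (simp add: norm_vec_def L2_set_def sum_nonneg)
    have "(norm (x (Suc t) - xstar))\<^sup>2 \<le> q * (norm (x t - xstar))\<^sup>2"
      unfolding norm2 sum_distrib_left using coord by (intro sum_mono) simp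
    then show "(norm (x (Suc t) - xstar))\<^sup>2 \<le>
        (1 - (2 - \<phi>) * \<phi> * (\<mu> / L) *
          ((1 - K1 * l t - K2 * \<bar>l t\<bar>) / (1 - K1 * l t + K2 * \<bar>l t\<bar>))\<^sup>2)
        * (norm (x t - xstar))\<^sup>2"
      unfolding q_def A_def B_def .
    show "1 - (2 - \<phi>) * \<phi> * (\<mu> / L) *
          ((1 - K1 * l t - K2 * \<bar>l t\<bar>) / (1 - K1 * l t + K2 * \<bar>l t\<bar>))\<^sup>2 \<ge> 1 - \<mu> / L"
      using rate_le_gradient_descent[OF A AB assms(2,1,13,14)] unfolding A_def B_def by simp
  qed
qed

end
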